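(* Consider the Markov decision process, uncertainty function $U$, target level $U_{\mathrm{mid}}$, level set $\mathcal{U}$, skew-symmetric matrix $W$, weights $\alpha,\beta$ and shaped reward $\tilde r$ described in the context, and suppose that: (A1) $U_{\mathrm{mid}}$ is a regular value of $U$; specifically, there exists $g_0>0$ such that $\|\nabla U(s)\|\ge g_0$ for all $s$ in a neighborhood of $\mathcal{U}$; (A2) for every stationary policy $\pi$ the induced Markov chain is ergodic and admits a unique stationary distribution $\mu_\pi$, and consequently the average reward $\rho^\pi:=\lim_{T\to\infty}\frac1T\mathbb{E}_\pi\left[\sum_{t=0}^{T-1}\tilde r(s_t,a_t,s_{t+1})\right]$ always exists; (A3) there exist constants $v_{\max}<\infty$, $v_0>0$ and a stationary policy $\pi_{\mathcal{U}}$ such that (i) $\mu_{\pi_{\mathcal{U}}}(\mathcal{U})=1$, and (ii) $\mathbb{E}_{\pi_{\mathcal{U}}}[\langle W\nabla U(s),\Delta_s\rangle]\ge v_0$, while for all policies $\pi$, $\mathbb{E}_\pi[|\langle W\nabla U(s),\Delta_s\rangle|]\le v_{\max}$. Further assume that the base reward of $\pi_{\mathcal{U}}$ is near-optimal among all policies supported on $\mathcal{U}$, in the sense that for some tolerance $\eta\ge 0$, $$\bar\rho_r^{\pi_{\mathcal{U}}}\ \ge\ \sup_{\pi:\,\mu_\pi(\mathcal{U})=1}\bar\rho_r^{\pi}\ -\ \eta .$$ Then any average-reward optimal policy $\pi^\star\in\arg\max_\pi\rho^\pi$ that satisfies $\mu_{\pi^\star}(\mathcal{U})=1$ must achieve strictly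 positive expected tangential motion: $$\mathbb{E}_{s\sim\mu_{\pi^\star}}\mathbb{E}_{a,s'}\left[\beta(s)\langle W\nabla U(s),\Delta_s\rangle\right]\ \ge\ v_0-\eta .$$ In particular, if $\eta<v_0$, then $\pi^\star$ cannot induce a self-loop ($s'=s$ almost surely) on a set of stationary mass $1$.
   Context: Setting. There is a Markov decision process with compact state space $\mathcal{S}\subset\mathbb{R}^d$, action space $\mathcal{A}$, transition kernel $P(\cdot\mid s,a)$ and bounded base reward $r(s,a)$, $|r(s,a)|\le R_{\max}$. For a transition $s\xrightarrow{a}s'$ (with $s'\sim P(\cdot\mid s,a)$), the step vector is $\Delta_s:=s'-s$. $U:\mathcal{S}\to\mathbb{R}$ is a twice continuously differentiable function (the uncertainty oracle), $U_{\mathrm{mid}}\in\mathbb{R}$ is a fixed target level, and $\mathcal{U}:=\{s\in\mathcal{S}:U(s)=U_{\mathrm{mid}}\}$. $W\in\mathbb{R}^{d\times d}$ is a constant skew-symmetric matrix, $W^\top=-W$. With $\Phi(s):=|U(s)-U_{\mathrm{mid}}|$ and $\Psi(s):=\log\cosh(\Phi(s))$, the maximum curvature $L_\Psi:=\sup_{x\in\mathcal{S}}\|\nabla^2\Psi(x)\|_{\mathrm{op}}$ is finite. Weights: $\alpha(s):=\mathrm{sign}(U_{\mathrm{mid}}-U(s))\tanh(|U(s)-U_{\mathrm{mid}}|)$ and $\beta(s):=1-|\tanh(U(s)-U_{\mathrm{mid}})|$. Shaped reward: $\tilde r(s,a,s'):=r(s,a)+\alpha(s)\langle\nabla U(s),\Delta_s\rangle+\beta(s)\langle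 W\nabla U(s),\Delta_s\rangle$. For a stationary policy $\pi$ with stationary distribution $\mu_\pi$, expectations $\mathbb{E}_\pi[\cdot]$ of functions of a single transition $(s,a,s')$ are taken with $s\sim\mu_\pi$, $a\sim\pi(\cdot\mid s)$, $s'\sim P(\cdot\mid s,a)$; the notation $\mathbb{E}_{s\sim\mu_{\pi}}\mathbb{E}_{a,s'}$ means the same. $\bar\rho_r^\pi:=\mathbb{E}_\pi[r(s,a)]$ is the long-run average base reward. The supremum and $\arg\max$ are over stationary policies. "Expected tangential motion" of $\pi^\star$ means the quantity $\mathbb{E}_{s\sim\mu_{\pi^\star}}\mathbb{E}_{a,s'}[\beta(s)\langle W\nabla U(s),\Delta_s\rangle]$. *)

theory Defs
  imports "HOL-Probability.Probability"
begin

section \<open>Gradients, Hessians and smoothness\<close>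

definition gradient :: "('s::real_inner \<Rightarrow> real) \<Rightarrow> 's \<Rightarrow> 's" where
  "gradient f x = (THE D. GDERIV f x :> D)"

definition hessian :: "(real^'n \<Rightarrow> real) \<Rightarrow> real^'n \<Rightarrow> real^'n^'n" where
  "hessian f x = matrix (frechet_derivative (gradient f) (at x))"

text \<open>A function on a closed set \<open>S\<close> (possibly without interior) is twice continuously
  differentiable if it is so on an open neighbourhood of \<open>S\<close>.\<close>

definition twice_continuously_differentiable_on :: "(real^'n \<Rightarrow> real) \<Rightarrow> (real^'n) set \<Rightarrow> bool" where
  "twice_continuously_differentiable_on f S \<longleftrightarrow>
     (\<exists>T g H. open T \<and> S \<subseteq> T \<and>
        (\<forall>x\<in>T. GDERIV f x :> g x) \<and>
        (\<forall>x\<in>T. (g has_derivative (\<lambda>v. H x *v v)) (at x)) \<and>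
        continuous_on T (H :: real^'n \<Rightarrow> real^'n^'n))"


section \<open>Markov chains and Markov decision processes\<close>

definition state_space :: "(real^'n) set \<Rightarrow> (real^'n) measure" where
  "state_space S = restrict_space borel S"

definition policies :: "(real^'n) set \<Rightarrow> 'a measure \<Rightarrow> (real^'n \<Rightarrow> 'a measure) set" where
  "policies S A = state_space S \<rightarrow>\<^sub>M prob_algebra A"

definition state_kernel ::
    "('s \<Rightarrow> 'a \<Rightarrow> 's measure) \<Rightarrow> ('s \<Rightarrow> 'a measure) \<Rightarrow> 's \<Rightarrow> 's measure" where
  "state_kernel P \<pi> s = do { a \<leftarrow> \<pi> s; P s a }"

definition is_stationary :: "'s measure \<Rightarrow> ('s \<Rightarrow> 's measure) \<Rightarrow> 's measure \<Rightarrow> bool" where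
  "is_stationary X K \<mu> \<longleftrightarrow> \<mu> \<in> space (prob_algebra X) \<and> (\<mu> \<bind> K) = \<mu>"

definition stationary_dist ::
    "(real^'n) set \<Rightarrow> (real^'n \<Rightarrow> 'a \<Rightarrow> (real^'n) measure) \<Rightarrow> (real^'n \<Rightarrow> 'a measure) \<Rightarrow> (real^'n) measure" where
  "stationary_dist S P \<pi> = (THE \<mu>. is_stationary (state_space S) (state_kernel P \<pi>) \<mu>)"

fun n_step :: "'s measure \<Rightarrow> ('s \<Rightarrow> 's measure) \<Rightarrow> nat \<Rightarrow> 's \<Rightarrow> 's measure" where
  "n_step X K 0 s = return X s"
| "n_step X K (Suc n) s = n_step X K n s \<bind> K"

definition total_variation :: "'s measure \<Rightarrow> 's measure \<Rightarrow> real" where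
  "total_variation M N = (SUP B\<in>sets M. \<bar>measure M B - measure N B\<bar>)"

text \<open>Ergodicity of a chain on a general state space, with limit law \<open>\<mu>\<close>: from every initial
  state, the law at time \<open>n\<close> tends to \<open>\<mu>\<close> in total variation.\<close>

definition ergodic_chain :: "'s measure \<Rightarrow> ('s \<Rightarrow> 's measure) \<Rightarrow> 's measure \<Rightarrow> bool" where
  "ergodic_chain X K \<mu> \<longleftrightarrow>
     is_stationary X K \<mu> \<and>
     (\<forall>s\<in>space X. (\<lambda>n. total_variation (n_step X K n s) \<mu>) \<longlonglongrightarrow> 0)"

definition transition_law ::
    "'s measure \<Rightarrow> 'a measure \<Rightarrow> ('s \<Rightarrow> 'a \<Rightarrow> 's measure) \<Rightarrow> ('s \<Rightarrow> 'a measure) \<Rightarrow> 's measure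
      \<Rightarrow> ('s \<times> 'a \<times> 's) measure" where
  "transition_law X A P \<pi> \<nu> =
     do { s \<leftarrow> \<nu>; a \<leftarrow> \<pi> s; s' \<leftarrow> P s a; return (X \<Otimes>\<^sub>M A \<Otimes>\<^sub>M X) (s, a, s') }"

definition stationary_expectation ::
    "(real^'n) set \<Rightarrow> 'a measure \<Rightarrow> (real^'n \<Rightarrow> 'a \<Rightarrow> (real^'n) measure) \<Rightarrow> (real^'n \<Rightarrow> 'a measure)
      \<Rightarrow> (real^'n \<Rightarrow> 'a \<Rightarrow> real^'n \<Rightarrow> real) \<Rightarrow> real" where
  "stationary_expectation S A P \<pi> f =
     (\<integral>(s, a, s'). f s a s' \<partial>transition_law (state_space S) A P \<pi> (stationary_dist S P \<pi>))"

text \<open>The law of the trajectory \<open>(s\<^sub>0, a\<^sub>0), (s\<^sub>1, a\<^sub>1), \<dots>\<close> under the policy \<open>\<pi>\<close> with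
  \<open>s\<^sub>0\<close> distributed as \<open>\<nu>\<close>, from the Ionescu-Tulcea theorem: \<open>trajectory_step\<close> is the conditional
  law of the \<open>n\<close>-th state-action pair given the earlier ones.\<close>

definition trajectory_step ::
    "'s measure \<Rightarrow> 'a measure \<Rightarrow> ('s \<Rightarrow> 'a \<Rightarrow> 's measure) \<Rightarrow> ('s \<Rightarrow> 'a measure) \<Rightarrow> 's measure
      \<Rightarrow> nat \<Rightarrow> (nat \<Rightarrow> 's \<times> 'a) \<Rightarrow> ('s \<times> 'a) measure" where
  "trajectory_step X A P \<pi> \<nu> n \<omega> =
     do { s \<leftarrow> (case n of 0 \<Rightarrow> \<nu> | Suc m \<Rightarrow> P (fst (\<omega> m)) (snd (\<omega> m)));
          a \<leftarrow> \<pi> s;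
          return (X \<Otimes>\<^sub>M A) (s, a) }"

definition trajectory_law ::
    "'s measure \<Rightarrow> 'a measure \<Rightarrow> ('s \<Rightarrow> 'a \<Rightarrow> 's measure) \<Rightarrow> ('s \<Rightarrow> 'a measure) \<Rightarrow> 's measure
      \<Rightarrow> (nat \<Rightarrow> 's \<times> 'a) measure" where
  "trajectory_law X A P \<pi> \<nu> =
     projective_family.lim UNIV
       (Ionescu_Tulcea.CI (trajectory_step X A P \<pi> \<nu>) (\<lambda>_. X \<Otimes>\<^sub>M A)) (\<lambda>_. X \<Otimes>\<^sub>M A)"

lemma Ionescu_Tulcea_trajectory_step:
  assumes P[measurable]: "(\<lambda>(s, a). P s a) \<in> X \<Otimes>\<^sub>M A \<rightarrow>\<^sub>M prob_algebra X"
    and \<pi>[measurable]: "\<pi> \<in> X \<rightarrow>\<^sub>M prob_algebra A"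
    and \<nu>: "\<nu> \<in> space (prob_algebra X)"
  shows "Ionescu_Tulcea (trajectory_step X A P \<pi> \<nu>) (\<lambda>_. X \<Otimes>\<^sub>M A)"
proof -
  have step: "trajectory_step X A P \<pi> \<nu> n \<in> PiM {0..<n} (\<lambda>_. X \<Otimes>\<^sub>M A) \<rightarrow>\<^sub>M prob_algebra (X \<Otimes>\<^sub>M A)" for n
  proof (cases n)
    case 0
    have [measurable]: "(\<lambda>_. \<nu>) \<in> PiM {0..<n} (\<lambda>_. X \<Otimes>\<^sub>M A) \<rightarrow>\<^sub>M prob_algebra X"
      using \<nu> by simp
    show ?thesis
      unfolding trajectory_step_def 0 nat.case using \<nu> by measurable
  next
    case (Suc m)
    have [measurable]: "(\<lambda>\<omega>. \<omega> m) \<in> PiM {0..<n} (\<lambda>_. X \<Otimes>\<^sub>M A) \<rightarrow>\<^sub>M X \<Otimes>\<^sub>M A"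
      using Suc by (intro measurable_component_singleton) auto
    have [measurable]: "(\<lambda>\<omega>. P (fst (\<omega> m)) (snd (\<omega> m))) \<in> PiM {0..<n} (\<lambda>_. X \<Otimes>\<^sub>M A) \<rightarrow>\<^sub>M prob_algebra X"
      using measurable_compose[OF \<open>(\<lambda>\<omega>. \<omega> m) \<in> _\<close> P] by (simp add: case_prod_unfold)
    show ?thesis
      unfolding trajectory_step_def Suc nat.case by (fold Suc) measurable
  qed
  show ?thesis
  proof (rule Ionescu_Tulcea.intro)
    fix n
    show "trajectory_step X A P \<pi> \<nu> n \<in> PiM {0..<n} (\<lambda>_. X \<Otimes>\<^sub>M A) \<rightarrow>\<^sub>M subprob_algebra (X \<Otimes>\<^sub>M A)"
      by (intro measurable_prob_algebraD step)
  next
    fix n and \<omega> :: "nat \<Rightarrow> 'a \<times> 'b"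
    assume "\<omega> \<in> space (PiM {0..<n} (\<lambda>_. X \<Otimes>\<^sub>M A))"
    from measurable_space[OF step this] show "prob_space (trajectory_step X A P \<pi> \<nu> n \<omega>)"
      by (simp add: space_prob_algebra)
  qed
qed

definition mean_reward ::
    "(real^'n) set \<Rightarrow> 'a measure \<Rightarrow> (real^'n \<Rightarrow> 'a \<Rightarrow> (real^'n) measure)
      \<Rightarrow> (real^'n \<Rightarrow> 'a \<Rightarrow> real^'n \<Rightarrow> real) \<Rightarrow> (real^'n) measure \<Rightarrow> (real^'n \<Rightarrow> 'a measure) \<Rightarrow> nat \<Rightarrow> real" where
  "mean_reward S A P f \<nu> \<pi> T =
     1 / real T *
       (\<integral>\<omega>. (\<Sum>t<T. f (fst (\<omega> t)) (snd (\<omega> t)) (fst (\<omega> (Suc t)))) \<partial>trajectory_law (state_space S) A P \<pi> \<nu>)"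

definition average_reward ::
    "(real^'n) set \<Rightarrow> 'a measure \<Rightarrow> (real^'n \<Rightarrow> 'a \<Rightarrow> (real^'n) measure)
      \<Rightarrow> (real^'n \<Rightarrow> 'a \<Rightarrow> real^'n \<Rightarrow> real) \<Rightarrow> (real^'n) measure \<Rightarrow> (real^'n \<Rightarrow> 'a measure) \<Rightarrow> real" where
  "average_reward S A P f \<nu> \<pi> = lim (mean_reward S A P f \<nu> \<pi>)"


section \<open>Uncertainty level, weights and shaped reward\<close>

definition level_set :: "'s set \<Rightarrow> ('s \<Rightarrow> real) \<Rightarrow> real \<Rightarrow> 's set" where
  "level_set S U c = {s \<in> S. U s = c}"

definition log_cosh_potential :: "('s \<Rightarrow> real) \<Rightarrow> real \<Rightarrow> 's \<Rightarrow> real" where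
  "log_cosh_potential U c s = ln (cosh \<bar>U s - c\<bar>)"

definition radial_weight :: "('s \<Rightarrow> real) \<Rightarrow> real \<Rightarrow> 's \<Rightarrow> real" where
  "radial_weight U c s = sgn (c - U s) * tanh \<bar>U s - c\<bar>"

definition tangential_weight :: "('s \<Rightarrow> real) \<Rightarrow> real \<Rightarrow> 's \<Rightarrow> real" where
  "tangential_weight U c s = 1 - \<bar>tanh (U s - c)\<bar>"

definition tangential_step :: "(real^'n \<Rightarrow> real) \<Rightarrow> real^'n^'n \<Rightarrow> real^'n \<Rightarrow> real^'n \<Rightarrow> real" where
  "tangential_step U W s s' = (W *v gradient U s) \<bullet> (s' - s)"

definition shaped_reward ::
    "(real^'n \<Rightarrow> 'a \<Rightarrow> real) \<Rightarrow> (real^'n \<Rightarrow> real) \<Rightarrow> real \<Rightarrow> real^'n^'n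
      \<Rightarrow> real^'n \<Rightarrow> 'a \<Rightarrow> real^'n \<Rightarrow> real" where
  "shaped_reward r U c W s a s' =
     r s a + radial_weight U c s * (gradient U s \<bullet> (s' - s))
           + tangential_weight U c s * tangential_step U W s s'"

end

theory Submission
  imports Defs
begin

text \<open>
  Ergodicity turns the average reward of every policy into a stationary expectation: the law of
  the state at time \<open>t\<close> converges setwise to the stationary distribution, hence so does the law
  of the transition at time \<open>t\<close>, and Cesaro means inherit the limit of the expected one-step
  rewards. Under a policy supported on the level set, \<open>\<alpha> = 0\<close> and \<open>\<beta> = 1\<close> almost surely, so its
  average reward is the base reward plus the tangential motion. Comparing the optimal policy
  with \<open>\<pi>\<^sub>U\<close>, whose base reward is at most \<open>\<eta>\<close> worse, leaves a tangential motion of at least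
  \<open>v0 - \<eta>\<close>. A self-loop almost surely would make the tangential motion vanish.
\<close>

section \<open>Gradients, Cesaro means and integrals under setwise convergence\<close>

lemma GDERIV_gradient:
  assumes "GDERIV f x :> D"
  shows "gradient f x = D"
  unfolding gradient_def
proof (rule the_equality[where a = D])
  show "GDERIV f x :> D" by fact
next
  fix E assume "GDERIV f x :> E"
  \<comment> \<open>Two gradients at the same point represent the same linear functional, and the
    inner product separates vectors.\<close>
  then have "(\<lambda>h. h \<bullet> E) = (\<lambda>h. h \<bullet> D)"
    using assms unfolding gderiv_def by (rule has_derivative_unique)
  then show "E = D"
    by (metis inner_commute vector_eq_rdot)
qed

text \<open>Split the sum of deviations at an index \<open>N\<close> past which each is below
  \<open>e / 2\<close>. The head has a fixed total, which the factor \<open>1 / T\<close> makes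
  small; the tail averages to at most \<open>e / 2\<close>.\<close>

lemma tendsto_cesaro_mean:
  fixes a :: "nat \<Rightarrow> real"
  assumes "a \<longlonglongrightarrow> L"
  shows "(\<lambda>T. 1 / real T * (\<Sum>t<T. a t)) \<longlonglongrightarrow> L"
proof (rule LIMSEQ_I)
  fix e :: real assume e: "e > 0"
  obtain N where N: "\<And>n. n \<ge> N \<Longrightarrow> \<bar>a n - L\<bar> < e / 2"
    using LIMSEQ_D[OF assms, of "e / 2"] e by auto
  define C where "C = (\<Sum>t<N. \<bar>a t - L\<bar>)"
  obtain M where M: "2 * C / e < real M"
    using reals_Archimedean2 by blast
  \<comment> \<open>\<open>M\<close> makes the head contribute strictly less than
    \<open>e / 2\<close>, and \<open>Suc\<close> keeps \<open>T\<close> positive so that dividing by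
    it is legitimate.\<close>
  have "norm (1 / real T * (\<Sum>t<T. a t) - L) < e" if T: "T \<ge> Suc (max N M)" for T
  proof -
    have T0: "real T > 0" and "2 * C / e < real T" using T M by auto
    then have CT: "C < real T * e / 2" using e by (simp add: field_simps)
    have "1 / real T * (\<Sum>t<T. a t) - L = 1 / real T * (\<Sum>t<T. a t - L)"
      using T0 by (simp add: sum_subtractf field_simps)
    also have "norm \<dots> \<le> 1 / real T * (\<Sum>t<T. \<bar>a t - L\<bar>)"
      by (simp add: abs_mult divide_right_mono)
    also have "(\<Sum>t<T. \<bar>a t - L\<bar>) = C + (\<Sum>t=N..<T. \<bar>a t - L\<bar>)"
      unfolding C_def lessThan_atLeast0 using T by (intro sum.atLeastLessThan_concat[symmetric]) auto
    also have "(\<Sum>t=N..<T. \<bar>a t - L\<bar>) \<le> real (card {N..<T}) * (e / 2)"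
      using N by (intro sum_bounded_above) (auto intro: less_imp_le)
    also have "\<dots> \<le> real T * (e / 2)"
      using e by (intro mult_right_mono) auto
    finally show ?thesis using T0 CT by (simp add: field_simps divide_right_mono)
  qed
  then show "\<exists>no. \<forall>n\<ge>no. norm (1 / real n * (\<Sum>t<n. a t) - L) < e" by blast
qed

text \<open>Convergence on all measurable sets survives a push-forward along any measurable
  \<open>f\<close>. This moves the question from \<open>X\<close>, which carries no topology, to the
  real line, where weak convergence is available.\<close>

lemma setwise_convergence_integral:
  fixes f :: "'b \<Rightarrow> real"
  assumes M: "\<And>n. M n \<in> space (prob_algebra X)" and N: "N \<in> space (prob_algebra X)"
    and setwise: "\<And>B. B \<in> sets X \<Longrightarrow> (\<lambda>n. measure (M n) B) \<longlonglongrightarrow> measure N B"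
    and f[measurable]: "f \<in> borel_measurable X"
    and bound: "\<And>x. x \<in> space X \<Longrightarrow> \<bar>f x\<bar> \<le> B"
  shows "(\<lambda>n. \<integral>x. f x \<partial>M n) \<longlonglongrightarrow> (\<integral>x. f x \<partial>N)"
proof -
  have sets_M[measurable_cong]: "\<And>n. sets (M n) = sets X" and sets_N[measurable_cong]: "sets N = sets X"
    and prob: "\<And>n. prob_space (M n)" "prob_space N"
    using M N by (auto simp: space_prob_algebra)
  text \<open>The push-forwards along \<open>f\<close> converge weakly, and \<open>clamp\<close> is a bounded continuous
    function on the reals that agrees with the identity on the range of \<open>f\<close>.\<close>
  define clamp where "clamp x = max (- B) (min B x)" for x :: real
  have distr: "real_distribution (distr (M n) borel f)" "real_distribution (distr N borel f)" for n
    unfolding real_distribution_def real_distribution_axioms_def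
    by (auto intro!: prob_space.prob_space_distr prob)
  have "weak_conv_m (\<lambda>n. distr (M n) borel f) (distr N borel f)"
  proof (rule continuity_set_conv_imp_weak_conv)
    fix C :: "real set" assume [measurable]: "C \<in> sets borel"
    have "f -` C \<inter> space X \<in> sets X" by measurable
    from setwise[OF this]
    show "(\<lambda>n. measure (distr (M n) borel f) C) \<longlonglongrightarrow> measure (distr N borel f) C"
      using sets_eq_imp_space_eq[OF sets_M] sets_eq_imp_space_eq[OF sets_N]
      by (simp add: measure_distr)
  qed (use distr in auto)
  \<comment> \<open>The constant \<open>\<bar>B\<bar>\<close> bounds \<open>clamp\<close> whatever
    the sign of \<open>B\<close>, so that sign need not be settled first.\<close>
  then have "(\<lambda>n. \<integral>x. clamp x \<partial>distr (M n) borel f) \<longlonglongrightarrow> (\<integral>x. clamp x \<partial>distr N borel f)"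
    using distr
    by (intro weak_conv_imp_integral_bdd_continuous_conv[where B="\<bar>B\<bar>"])
       (auto simp: clamp_def intro!: continuous_intros)
  moreover have [measurable]: "clamp \<in> borel_measurable borel"
    unfolding clamp_def by measurable
  moreover have "clamp (f x) = f x" if "x \<in> space X" for x
    using bound[OF that] by (auto simp: clamp_def)
  then have "(\<integral>x. clamp (f x) \<partial>M n) = (\<integral>x. f x \<partial>M n)" "(\<integral>x. clamp (f x) \<partial>N) = (\<integral>x. f x \<partial>N)" for n
    using sets_eq_imp_space_eq[OF sets_M] sets_eq_imp_space_eq[OF sets_N]
    by (auto intro!: Bochner_Integration.integral_cong)
  ultimately show ?thesis
    by (simp add: integral_distr)
qed

section \<open>One-step kernels of a fixed policy: iterated integrals and null sets\<close>

locale policy_chain =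
  fixes X :: "'s measure" and A :: "'a measure" and P :: "'s \<Rightarrow> 'a \<Rightarrow> 's measure"
    and \<pi> :: "'s \<Rightarrow> 'a measure"
  assumes P[measurable]: "(\<lambda>(s, a). P s a) \<in> X \<Otimes>\<^sub>M A \<rightarrow>\<^sub>M prob_algebra X"
    and policy[measurable]: "\<pi> \<in> X \<rightarrow>\<^sub>M prob_algebra A"
begin

text \<open>With the initial state held fixed, \<open>transition_law\<close> depends on the initial
  law through a single bind. Limits of state laws can then be transferred to transition laws by
  integrating over the state.\<close>

definition transition_kernel :: "'s \<Rightarrow> ('s \<times> 'a \<times> 's) measure" where
  "transition_kernel s = do { a \<leftarrow> \<pi> s; s' \<leftarrow> P s a; return (X \<Otimes>\<^sub>M A \<Otimes>\<^sub>M X) (s, a, s') }"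

lemma transition_law_eq_bind: "transition_law X A P \<pi> \<mu> = \<mu> \<bind> transition_kernel"
  unfolding transition_law_def transition_kernel_def ..

lemma measurable_state_kernel[measurable]: "state_kernel P \<pi> \<in> X \<rightarrow>\<^sub>M prob_algebra X"
  unfolding state_kernel_def by measurable

lemma measurable_transition_kernel[measurable]:
  "transition_kernel \<in> X \<rightarrow>\<^sub>M prob_algebra (X \<Otimes>\<^sub>M A \<Otimes>\<^sub>M X)"
  unfolding transition_kernel_def by measurable

lemma measurable_n_step[measurable]: "n_step X (state_kernel P \<pi>) n \<in> X \<rightarrow>\<^sub>M prob_algebra X"
  by (induction n) auto

lemma kernel_in_prob_algebra: "s \<in> space X \<Longrightarrow> a \<in> space A \<Longrightarrow> P s a \<in> space (prob_algebra X)"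
  using measurable_space[OF P, of "(s, a)"] by (auto simp: space_pair_measure)

lemma nn_integral_state_kernel:
  assumes [measurable]: "f \<in> borel_measurable X" and s[measurable]: "s \<in> space X"
  shows "(\<integral>\<^sup>+s'. f s' \<partial>state_kernel P \<pi> s) = (\<integral>\<^sup>+a. \<integral>\<^sup>+s'. f s' \<partial>P s a \<partial>\<pi> s)"
proof -
  have [measurable_cong]: "sets (\<pi> s) = sets A" and "prob_space (\<pi> s)"
    using measurable_space[OF policy s] by (auto simp: space_prob_algebra)
  have "P s \<in> A \<rightarrow>\<^sub>M prob_algebra X" by measurable
  then have "P s \<in> \<pi> s \<rightarrow>\<^sub>M subprob_algebra X"
    by (intro measurable_prob_algebraD) measurable
  then show ?thesis unfolding state_kernel_def by (intro nn_integral_bind[where B=X]) auto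
qed

lemma nn_integral_transition_kernel:
  assumes f[measurable]: "f \<in> borel_measurable (X \<Otimes>\<^sub>M A \<Otimes>\<^sub>M X)" and s[measurable]: "s \<in> space X"
  shows "(\<integral>\<^sup>+x. f x \<partial>transition_kernel s) = (\<integral>\<^sup>+a. \<integral>\<^sup>+s'. f (s, a, s') \<partial>P s a \<partial>\<pi> s)"
proof -
  have [measurable_cong]: "sets (\<pi> s) = sets A" and space_\<pi>: "space (\<pi> s) = space A"
    using measurable_space[OF policy s] by (auto simp: space_prob_algebra dest: sets_eq_imp_space_eq)
  have "(\<lambda>a. P s a \<bind> (\<lambda>s'. return (X \<Otimes>\<^sub>M A \<Otimes>\<^sub>M X) (s, a, s'))) \<in> \<pi> s \<rightarrow>\<^sub>M subprob_algebra (X \<Otimes>\<^sub>M A \<Otimes>\<^sub>M X)"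
    by (intro measurable_prob_algebraD) measurable
  then have "(\<integral>\<^sup>+x. f x \<partial>transition_kernel s)
      = (\<integral>\<^sup>+a. \<integral>\<^sup>+x. f x \<partial>(P s a \<bind> (\<lambda>s'. return (X \<Otimes>\<^sub>M A \<Otimes>\<^sub>M X) (s, a, s'))) \<partial>\<pi> s)"
    unfolding transition_kernel_def by (intro nn_integral_bind[OF f])
  also have "\<dots> = (\<integral>\<^sup>+a. \<integral>\<^sup>+s'. f (s, a, s') \<partial>P s a \<partial>\<pi> s)"
  proof (intro nn_integral_cong)
    fix a assume "a \<in> space (\<pi> s)"
    then have a[measurable]: "a \<in> space A" by (simp add: space_\<pi>)
    from kernel_in_prob_algebra[OF s a]
    have [measurable_cong]: "sets (P s a) = sets X" and space_P: "space (P s a) = space X"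
      by (auto simp: space_prob_algebra dest: sets_eq_imp_space_eq)
    have "(\<lambda>s'. return (X \<Otimes>\<^sub>M A \<Otimes>\<^sub>M X) (s, a, s')) \<in> P s a \<rightarrow>\<^sub>M subprob_algebra (X \<Otimes>\<^sub>M A \<Otimes>\<^sub>M X)"
      by measurable
    then show "(\<integral>\<^sup>+x. f x \<partial>(P s a \<bind> (\<lambda>s'. return (X \<Otimes>\<^sub>M A \<Otimes>\<^sub>M X) (s, a, s'))))
        = (\<integral>\<^sup>+s'. f (s, a, s') \<partial>P s a)"
      using s a by (subst nn_integral_bind[OF f])
        (auto intro!: nn_integral_cong simp: nn_integral_return space_pair_measure space_P)
  qed
  finally show ?thesis .
qed

lemma transition_law_in_prob_algebra:
  assumes "\<mu> \<in> space (prob_algebra X)"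
  shows "transition_law X A P \<pi> \<mu> \<in> space (prob_algebra (X \<Otimes>\<^sub>M A \<Otimes>\<^sub>M X))"
  using prob_space_bind'[OF assms measurable_transition_kernel]
    sets_bind'[OF assms measurable_transition_kernel]
  by (simp add: transition_law_eq_bind space_prob_algebra)

text \<open>A self-loop is a condition on the state chain, whereas transitions record the action as
  well. This passes from the kernel mixed over actions to almost every single action.\<close>

lemma AE_state_kernel_iff:
  assumes [measurable]: "Measurable.pred X Q" and s[measurable]: "s \<in> space X"
  shows "(AE s' in state_kernel P \<pi> s. Q s') \<longleftrightarrow> (AE a in \<pi> s. AE s' in P s a. Q s')"
proof -
  have [measurable_cong]: "sets (\<pi> s) = sets A"
    using measurable_space[OF policy s] by (auto simp: space_prob_algebra)
  have "P s \<in> \<pi> s \<rightarrow>\<^sub>M subprob_algebra X"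
    by (intro measurable_prob_algebraD) measurable
  then show ?thesis unfolding state_kernel_def by (intro AE_bind[where B=X]) auto
qed

lemma AE_transition_kernel_iff:
  assumes Q[measurable]: "Measurable.pred (X \<Otimes>\<^sub>M A \<Otimes>\<^sub>M X) Q" and s[measurable]: "s \<in> space X"
  shows "(AE x in transition_kernel s. Q x) \<longleftrightarrow> (AE a in \<pi> s. AE s' in P s a. Q (s, a, s'))"
proof -
  have sets_\<kappa>: "sets (transition_kernel s) = sets (X \<Otimes>\<^sub>M A \<Otimes>\<^sub>M X)"
    using measurable_space[OF measurable_transition_kernel s] by (simp add: space_prob_algebra)
  have [measurable_cong]: "sets (\<pi> s) = sets A" and space_\<pi>: "space (\<pi> s) = space A"
    using measurable_space[OF policy s] by (auto simp: space_prob_algebra dest: sets_eq_imp_space_eq)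
  have "(\<lambda>a. P s a \<bind> (\<lambda>s'. return (X \<Otimes>\<^sub>M A \<Otimes>\<^sub>M X) (s, a, s'))) \<in> \<pi> s \<rightarrow>\<^sub>M subprob_algebra (X \<Otimes>\<^sub>M A \<Otimes>\<^sub>M X)"
    by (intro measurable_prob_algebraD) measurable
  then have "(AE x in transition_kernel s. Q x) \<longleftrightarrow>
      (AE a in \<pi> s. AE x in P s a \<bind> (\<lambda>s'. return (X \<Otimes>\<^sub>M A \<Otimes>\<^sub>M X) (s, a, s')). Q x)"
    unfolding transition_kernel_def by (intro AE_bind[OF _ Q])
  also have "\<dots> \<longleftrightarrow> (AE a in \<pi> s. AE s' in P s a. Q (s, a, s'))"
  proof (intro AE_cong)
    fix a assume "a \<in> space (\<pi> s)"
    then have a[measurable]: "a \<in> space A" by (simp add: space_\<pi>)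
    from kernel_in_prob_algebra[OF s a]
    have [measurable_cong]: "sets (P s a) = sets X" and space_P: "space (P s a) = space X"
      by (auto simp: space_prob_algebra dest: sets_eq_imp_space_eq)
    have "(\<lambda>s'. return (X \<Otimes>\<^sub>M A \<Otimes>\<^sub>M X) (s, a, s')) \<in> P s a \<rightarrow>\<^sub>M subprob_algebra (X \<Otimes>\<^sub>M A \<Otimes>\<^sub>M X)"
      by measurable
    then show "(AE x in P s a \<bind> (\<lambda>s'. return (X \<Otimes>\<^sub>M A \<Otimes>\<^sub>M X) (s, a, s')). Q x) \<longleftrightarrow>
        (AE s' in P s a. Q (s, a, s'))"
      using s a by (subst AE_bind[OF _ Q])
        (auto intro!: AE_cong simp: AE_return space_pair_measure space_P)
  qed
  finally show ?thesis .
qed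

text \<open>Null sets of a bind are found draw by draw. In this form, support on the level set and
  self-loops, both known for almost every state, carry over to transitions.\<close>

lemma AE_transition_law_iff:
  assumes \<mu>: "\<mu> \<in> space (prob_algebra X)" and Q: "Measurable.pred (X \<Otimes>\<^sub>M A \<Otimes>\<^sub>M X) Q"
  shows "(AE x in transition_law X A P \<pi> \<mu>. Q x) \<longleftrightarrow>
    (AE s in \<mu>. AE a in \<pi> s. AE s' in P s a. Q (s, a, s'))"
proof -
  have [measurable_cong]: "sets \<mu> = sets X" and space_\<mu>: "space \<mu> = space X"
    using \<mu> by (auto simp: space_prob_algebra dest: sets_eq_imp_space_eq)
  have "transition_kernel \<in> \<mu> \<rightarrow>\<^sub>M subprob_algebra (X \<Otimes>\<^sub>M A \<Otimes>\<^sub>M X)"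
    by (intro measurable_prob_algebraD) measurable
  then show ?thesis
    unfolding transition_law_eq_bind
    by (subst AE_bind[OF _ Q]) (auto intro!: AE_cong AE_transition_kernel_iff[OF Q] simp: space_\<mu>)
qed

section \<open>The law of the state at time t and its setwise limit\<close>

abbreviation state_law :: "'s measure \<Rightarrow> nat \<Rightarrow> 's measure" where
  "state_law \<nu> t \<equiv> \<nu> \<bind> n_step X (state_kernel P \<pi>) t"

lemma state_law_in_prob_algebra:
  assumes "\<nu> \<in> space (prob_algebra X)"
  shows "state_law \<nu> t \<in> space (prob_algebra X)"
  using prob_space_bind'[OF assms measurable_n_step] sets_bind'[OF assms measurable_n_step]
  by (simp add: space_prob_algebra)

lemma state_law_0:
  assumes "\<nu> \<in> space (prob_algebra X)"
  shows "state_law \<nu> 0 = \<nu>"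
proof -
  have "n_step X (state_kernel P \<pi>) 0 = return X" by (rule ext) simp
  with assms show ?thesis by (simp add: bind_return'' space_prob_algebra)
qed

lemma state_law_Suc:
  assumes "\<nu> \<in> space (prob_algebra X)"
  shows "state_law \<nu> (Suc t) = state_law \<nu> t \<bind> state_kernel P \<pi>"
proof -
  have [measurable_cong]: "sets \<nu> = sets X" using assms by (auto simp: space_prob_algebra)
  have "n_step X (state_kernel P \<pi>) t \<in> \<nu> \<rightarrow>\<^sub>M subprob_algebra X"
    "state_kernel P \<pi> \<in> X \<rightarrow>\<^sub>M subprob_algebra X"
    by (intro measurable_prob_algebraD; measurable)+
  moreover have "n_step X (state_kernel P \<pi>) (Suc t) = (\<lambda>s. n_step X (state_kernel P \<pi>) t s \<bind> state_kernel P \<pi>)"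
    by (rule ext) simp
  ultimately show ?thesis by (simp only: bind_assoc)
qed

text \<open>From a fixed initial state, total variation dominates the difference on each single set
  \<open>B\<close>. A general initial law is a mixture of such starts, and dominated convergence
  with the constant 1 handles the mixture.\<close>

lemma setwise_convergence_state_law:
  assumes erg: "ergodic_chain X (state_kernel P \<pi>) \<mu>" and \<nu>: "\<nu> \<in> space (prob_algebra X)"
    and B[measurable]: "B \<in> sets X"
  shows "(\<lambda>t. measure (state_law \<nu> t) B) \<longlonglongrightarrow> measure \<mu> B"
proof -
  have [measurable_cong]: "sets \<nu> = sets X" and space_\<nu>: "space \<nu> = space X" and "prob_space \<nu>"
    using \<nu> by (auto simp: space_prob_algebra dest: sets_eq_imp_space_eq)
  interpret \<nu>: prob_space \<nu> by fact
  have \<mu>: "prob_space \<mu>" using erg by (auto simp: ergodic_chain_def is_stationary_def space_prob_algebra)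
  let ?p = "\<lambda>t s. n_step X (state_kernel P \<pi>) t s"
  have "(\<lambda>t. measure (?p t s) B) \<longlonglongrightarrow> measure \<mu> B" if s: "s \<in> space X" for s
  proof -
    have p: "prob_space (?p t s)" "sets (?p t s) = sets X" for t
      using measurable_space[OF measurable_n_step s] by (auto simp: space_prob_algebra)
    have bound: "\<bar>measure (?p t s) B - measure \<mu> B\<bar> \<le> total_variation (?p t s) \<mu>" for t
      unfolding total_variation_def
    proof (rule cSUP_upper)
      \<comment> \<open>The real supremum in \<open>total_variation\<close> dominates its members
        only for a bounded family; differences of probabilities are at most 1 in absolute
        value.\<close>
      have "\<bar>measure (?p t s) C - measure \<mu> C\<bar> \<le> 1" for C
        using prob_space.prob_le_1[OF p(1), of t C] prob_space.prob_le_1[OF \<mu>, of C]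
          measure_nonneg[of "?p t s" C] measure_nonneg[of \<mu> C] by linarith
      then show "bdd_above ((\<lambda>C. \<bar>measure (?p t s) C - measure \<mu> C\<bar>) ` sets (?p t s))"
        by (rule bdd_aboveI2)
    qed (simp add: p)
    have "(\<lambda>t. total_variation (?p t s) \<mu>) \<longlonglongrightarrow> 0"
      using erg s by (auto simp: ergodic_chain_def)
    then have "(\<lambda>t. measure (?p t s) B - measure \<mu> B) \<longlonglongrightarrow> 0"
      by (rule Lim_null_comparison[rotated])
        (unfold real_norm_def, rule always_eventually, rule allI, rule bound)
    then show ?thesis by (rule LIM_zero_cancel)
  qed
  then have "(\<lambda>t. \<integral>s. measure (?p t s) B \<partial>\<nu>) \<longlonglongrightarrow> (\<integral>s. measure \<mu> B \<partial>\<nu>)"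
  proof (intro integral_dominated_convergence[where w="\<lambda>_. 1"])
    show "AE s in \<nu>. norm (measure (?p t s) B) \<le> 1" for t
      using measurable_space[OF measurable_n_step, of _ t]
      by (intro AE_I2) (auto simp: space_\<nu> space_prob_algebra intro!: prob_space.prob_le_1)
  qed (auto simp: space_\<nu>)
  moreover have "?p t \<in> \<nu> \<rightarrow>\<^sub>M subprob_algebra X" for t
    by (intro measurable_prob_algebraD) measurable
  ultimately show ?thesis
    by (simp add: \<nu>.measure_bind[OF _ B] \<nu>.prob_space)
qed

text \<open>The mass of \<open>B\<close> under a transition law is the integral, over the state, of
  the function \<open>measure (transition_kernel s) B\<close>. This function is measurable and
  bounded by 1, so setwise convergence of the state laws suffices.\<close>

lemma setwise_convergence_transition_law:
  assumes erg: "ergodic_chain X (state_kernel P \<pi>) \<mu>" and \<nu>: "\<nu> \<in> space (prob_algebra X)"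
    and B[measurable]: "B \<in> sets (X \<Otimes>\<^sub>M A \<Otimes>\<^sub>M X)"
  shows "(\<lambda>t. measure (transition_law X A P \<pi> (state_law \<nu> t)) B)
    \<longlonglongrightarrow> measure (transition_law X A P \<pi> \<mu>) B"
proof -
  have \<mu>: "\<mu> \<in> space (prob_algebra X)"
    using erg by (auto simp: ergodic_chain_def is_stationary_def)
  have measure_eq: "measure (transition_law X A P \<pi> M) B = (\<integral>s. measure (transition_kernel s) B \<partial>M)"
    if M: "M \<in> space (prob_algebra X)" for M
  proof -
    have [measurable_cong]: "sets M = sets X" using M by (simp add: space_prob_algebra)
    have "transition_kernel \<in> M \<rightarrow>\<^sub>M subprob_algebra (X \<Otimes>\<^sub>M A \<Otimes>\<^sub>M X)"
      by (intro measurable_prob_algebraD) measurable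
    moreover have "subprob_space M"
      using M by (auto simp: space_prob_algebra intro: prob_space_imp_subprob_space)
    ultimately show ?thesis
      unfolding transition_law_eq_bind by (simp add: subprob_space.measure_bind[OF _ _ B])
  qed
  have "\<bar>measure (transition_kernel s) B\<bar> \<le> 1" if "s \<in> space X" for s
    using measurable_space[OF measurable_transition_kernel that]
    by (auto simp: space_prob_algebra intro!: prob_space.prob_le_1)
  then show ?thesis
    unfolding measure_eq[OF state_law_in_prob_algebra[OF \<nu>]] measure_eq[OF \<mu>]
    by (intro setwise_convergence_integral[of _ X _ _ 1])
       (auto intro: \<mu> state_law_in_prob_algebra[OF \<nu>] setwise_convergence_state_law[OF erg \<nu>])
qed

lemma nn_integral_transition_law:
  assumes \<mu>: "\<mu> \<in> space (prob_algebra X)" and f: "f \<in> borel_measurable (X \<Otimes>\<^sub>M A \<Otimes>\<^sub>M X)"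
  shows "(\<integral>\<^sup>+x. f x \<partial>transition_law X A P \<pi> \<mu>)
    = (\<integral>\<^sup>+s. \<integral>\<^sup>+a. \<integral>\<^sup>+s'. f (s, a, s') \<partial>P s a \<partial>\<pi> s \<partial>\<mu>)"
proof -
  have [measurable_cong]: "sets \<mu> = sets X" and space_\<mu>: "space \<mu> = space X"
    using \<mu> by (auto simp: space_prob_algebra dest: sets_eq_imp_space_eq)
  have "transition_kernel \<in> \<mu> \<rightarrow>\<^sub>M subprob_algebra (X \<Otimes>\<^sub>M A \<Otimes>\<^sub>M X)"
    by (intro measurable_prob_algebraD) measurable
  then show ?thesis
    unfolding transition_law_eq_bind
    by (subst nn_integral_bind[OF f])
       (auto intro!: nn_integral_cong nn_integral_transition_kernel[OF f] simp: space_\<mu>)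
qed

lemma measurable_nn_integral_policy[measurable]:
  "f \<in> borel_measurable (X \<Otimes>\<^sub>M A) \<Longrightarrow> (\<lambda>s. \<integral>\<^sup>+a. f (s, a) \<partial>\<pi> s) \<in> borel_measurable X"
  by (rule nn_integral_measurable_subprob_algebra2[OF _ measurable_prob_algebraD[OF policy]]) simp

text \<open>Every trajectory step has this shape: a state is drawn from the initial law or from a
  row of \<open>P\<close>, then an action from the policy.\<close>

lemma nn_integral_state_policy:
  assumes \<mu>: "\<mu> \<in> space (prob_algebra X)" and f[measurable]: "f \<in> borel_measurable (X \<Otimes>\<^sub>M A)"
  shows "(\<integral>\<^sup>+x. f x \<partial>(\<mu> \<bind> (\<lambda>s. \<pi> s \<bind> (\<lambda>a. return (X \<Otimes>\<^sub>M A) (s, a))))) = (\<integral>\<^sup>+s. \<integral>\<^sup>+a. f (s, a) \<partial>\<pi> s \<partial>\<mu>)"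
proof -
  have [measurable_cong]: "sets \<mu> = sets X" and space_\<mu>: "space \<mu> = space X"
    using \<mu> by (auto simp: space_prob_algebra dest: sets_eq_imp_space_eq)
  have "(\<lambda>s. \<pi> s \<bind> (\<lambda>a. return (X \<Otimes>\<^sub>M A) (s, a))) \<in> \<mu> \<rightarrow>\<^sub>M subprob_algebra (X \<Otimes>\<^sub>M A)"
    by (intro measurable_prob_algebraD) measurable
  then have "(\<integral>\<^sup>+x. f x \<partial>(\<mu> \<bind> (\<lambda>s. \<pi> s \<bind> (\<lambda>a. return (X \<Otimes>\<^sub>M A) (s, a)))))
      = (\<integral>\<^sup>+s. \<integral>\<^sup>+x. f x \<partial>(\<pi> s \<bind> (\<lambda>a. return (X \<Otimes>\<^sub>M A) (s, a))) \<partial>\<mu>)"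
    by (rule nn_integral_bind[OF f])
  also have "\<dots> = (\<integral>\<^sup>+s. \<integral>\<^sup>+a. f (s, a) \<partial>\<pi> s \<partial>\<mu>)"
  proof (intro nn_integral_cong)
    fix s assume "s \<in> space \<mu>"
    then have s[measurable]: "s \<in> space X" by (simp add: space_\<mu>)
    have [measurable_cong]: "sets (\<pi> s) = sets A" and space_\<pi>: "space (\<pi> s) = space A"
      using measurable_space[OF policy s] by (auto simp: space_prob_algebra dest: sets_eq_imp_space_eq)
    have "(\<lambda>a. return (X \<Otimes>\<^sub>M A) (s, a)) \<in> \<pi> s \<rightarrow>\<^sub>M subprob_algebra (X \<Otimes>\<^sub>M A)"
      by measurable
    then show "(\<integral>\<^sup>+x. f x \<partial>(\<pi> s \<bind> (\<lambda>a. return (X \<Otimes>\<^sub>M A) (s, a)))) = (\<integral>\<^sup>+a. f (s, a) \<partial>\<pi> s)"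
      using s by (subst nn_integral_bind[OF f])
        (auto intro!: nn_integral_cong simp: nn_integral_return space_pair_measure space_\<pi>)
  qed
  finally show ?thesis .
qed

section \<open>Marginals of the Ionescu-Tulcea trajectory law, and time averages\<close>

context
  fixes \<nu> :: "'s measure"
  assumes \<nu>: "\<nu> \<in> space (prob_algebra X)"
begin

interpretation IT: Ionescu_Tulcea "trajectory_step X A P \<pi> \<nu>" "\<lambda>_. X \<Otimes>\<^sub>M A"
  by (rule Ionescu_Tulcea_trajectory_step[OF P policy \<nu>])

abbreviation history_space :: "nat \<Rightarrow> (nat \<Rightarrow> 's \<times> 'a) measure" where
  "history_space n \<equiv> PiM {0..<n} (\<lambda>_. X \<Otimes>\<^sub>M A)"

text \<open>The construction starts at time 0 from the empty history. The product over the empty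
  index set has exactly one element, the function that is \<open>undefined\<close>
  everywhere.\<close>

abbreviation history_law :: "nat \<Rightarrow> (nat \<Rightarrow> 's \<times> 'a) measure" where
  "history_law n \<equiv> IT.C 0 n (\<lambda>_. undefined)"

lemma space_history_law: "space (history_law n) = space (history_space n)"
  and sets_history_law: "sets (history_law n) = sets (history_space n)"
  using IT.space_C[of "\<lambda>_. undefined" 0 n] IT.sets_C[of "\<lambda>_. undefined" 0 n] by simp_all

text \<open>A push-forward preserves total mass, so it is enough to look at the marginal on the
  empty set of coordinates.\<close>

lemma prob_space_trajectory_law: "prob_space (trajectory_law X A P \<pi> \<nu>)"
proof -
  have "prob_space (distr (trajectory_law X A P \<pi> \<nu>) (PiM {} (\<lambda>_. X \<Otimes>\<^sub>M A)) (\<lambda>\<omega>. restrict \<omega> {}))"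
    unfolding trajectory_law_def using IT.distr_lim[of "{}"] IT.PF.prob_space_P[of "{}"] by simp
  then show ?thesis
    by (rule prob_space_distrD[rotated]) (simp add: trajectory_law_def measurable_cong_sets[OF IT.PF.sets_lim refl])
qed

lemma sets_trajectory_law: "sets (trajectory_law X A P \<pi> \<nu>) = sets (PiM UNIV (\<lambda>_. X \<Otimes>\<^sub>M A))"
  unfolding trajectory_law_def by simp

lemma distr_trajectory_law_restrict:
  "distr (trajectory_law X A P \<pi> \<nu>) (history_space n) (\<lambda>\<omega>. restrict \<omega> {0..<n}) = history_law n"
proof -
  \<comment> \<open>\<open>IT.CI\<close> obtains a finite marginal by projecting the law of the
    shortest history that covers the index set. For an initial segment this history is the segment
    itself, and the projection changes nothing.\<close>
  have "IT.up_to {0..<n} = n"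
    unfolding IT.up_to_def by (rule Least_equality) (auto simp: not_le[symmetric])
  then have "IT.CI {0..<n} = distr (history_law n) (history_space n) (\<lambda>\<omega>. restrict \<omega> {0..<n})"
    by (simp add: IT.CI_def)
  also have "\<dots> = history_law n"
    using IT.distr_C[of n n "\<lambda>_. undefined" 0] by simp
  finally show ?thesis
    unfolding trajectory_law_def using IT.distr_lim[of "{0..<n}"] by simp
qed

lemma nn_integral_history_law_Suc:
  assumes "f \<in> borel_measurable (history_space (Suc n))"
  shows "(\<integral>\<^sup>+\<omega>. f \<omega> \<partial>history_law (Suc n))
    = (\<integral>\<^sup>+\<omega>. \<integral>\<^sup>+x. f (fun_upd \<omega> n x) \<partial>trajectory_step X A P \<pi> \<nu> n \<omega> \<partial>history_law n)"
proof -
  have "IT.eP n \<in> history_law n \<rightarrow>\<^sub>M subprob_algebra (history_space (Suc n))"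
    using IT.measurable_eP[of n] by (simp cong: measurable_cong_sets add: measurable_cong_sets[OF sets_history_law])
  then have "(\<integral>\<^sup>+\<omega>. f \<omega> \<partial>history_law (Suc n)) = (\<integral>\<^sup>+\<omega>. \<integral>\<^sup>+x. f x \<partial>IT.eP n \<omega> \<partial>history_law n)"
    using assms by (simp add: nn_integral_bind)
  also have "\<dots> = (\<integral>\<^sup>+\<omega>. \<integral>\<^sup>+x. f (fun_upd \<omega> n x) \<partial>trajectory_step X A P \<pi> \<nu> n \<omega> \<partial>history_law n)"
    using assms by (intro nn_integral_cong) (simp add: space_history_law IT.nn_integral_eP)
  finally show ?thesis .
qed

text \<open>This is the Markov property: of the whole history, the step kernel reads only the last
  state-action pair.\<close>

lemma nn_integral_trajectory_step_Suc:
  assumes \<omega>: "\<omega> \<in> space (history_space (Suc n))" and f: "f \<in> borel_measurable (X \<Otimes>\<^sub>M A)"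
  shows "(\<integral>\<^sup>+x. f x \<partial>trajectory_step X A P \<pi> \<nu> (Suc n) \<omega>)
    = (\<integral>\<^sup>+s. \<integral>\<^sup>+a. f (s, a) \<partial>\<pi> s \<partial>P (fst (\<omega> n)) (snd (\<omega> n)))"
proof -
  have "\<omega> n \<in> space (X \<Otimes>\<^sub>M A)"
    using \<omega> by (auto simp: space_PiM PiE_iff)
  then show ?thesis
    unfolding trajectory_step_def nat.case
    by (intro nn_integral_state_policy[OF kernel_in_prob_algebra f]) (auto simp: space_pair_measure)
qed

text \<open>Links the path-space construction to the iterated kernel \<open>n_step\<close>. The
  induction runs over all \<open>f\<close>, because integrating out the newest pair leaves a
  different integrand in the previous pair.\<close>

lemma nn_integral_history_law_last:
  assumes f[measurable]: "f \<in> borel_measurable (X \<Otimes>\<^sub>M A)"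
  shows "(\<integral>\<^sup>+\<omega>. f (\<omega> n) \<partial>history_law (Suc n)) = (\<integral>\<^sup>+s. \<integral>\<^sup>+a. f (s, a) \<partial>\<pi> s \<partial>state_law \<nu> n)"
  using f
proof (induction n arbitrary: f)
  case 0
  note [measurable] = 0
  have "(\<integral>\<^sup>+\<omega>. f (\<omega> 0) \<partial>history_law (Suc 0)) = (\<integral>\<^sup>+x. f x \<partial>trajectory_step X A P \<pi> \<nu> 0 (\<lambda>_. undefined))"
    by (subst nn_integral_history_law_Suc)
      (auto simp: trajectory_step_def space_PiM PiM_empty)
  then show ?case
    unfolding trajectory_step_def nat.case
    by (simp only: nn_integral_state_policy[OF \<nu> 0] state_law_0[OF \<nu>])
next
  case (Suc n)
  note [measurable] = Suc.prems
  \<comment> \<open>\<open>?g\<close> integrates out the newest action and \<open>?h\<close> then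
    the newest state, which leaves a function of the pair at time \<open>n\<close>.\<close>
  let ?g = "\<lambda>s. \<integral>\<^sup>+a. f (s, a) \<partial>\<pi> s"
  have g[measurable]: "?g \<in> borel_measurable X" by measurable
  let ?h = "\<lambda>(s, a). \<integral>\<^sup>+s'. ?g s' \<partial>P s a"
  have h: "?h \<in> borel_measurable (X \<Otimes>\<^sub>M A)"
    using measurable_compose[OF measurable_prob_algebraD[OF P] nn_integral_measurable_subprob_algebra[OF g]]
    by (simp add: case_prod_unfold)
  have [measurable_cong]: "sets (state_law \<nu> n) = sets X" and space_law: "space (state_law \<nu> n) = space X"
    using state_law_in_prob_algebra[OF \<nu>] by (auto simp: space_prob_algebra dest: sets_eq_imp_space_eq)
  have K: "state_kernel P \<pi> \<in> state_law \<nu> n \<rightarrow>\<^sub>M subprob_algebra X"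
    by (intro measurable_prob_algebraD) measurable
  have "(\<integral>\<^sup>+\<omega>. f (\<omega> (Suc n)) \<partial>history_law (Suc (Suc n)))
      = (\<integral>\<^sup>+\<omega>. \<integral>\<^sup>+x. f x \<partial>trajectory_step X A P \<pi> \<nu> (Suc n) \<omega> \<partial>history_law (Suc n))"
    by (subst nn_integral_history_law_Suc) auto
  also have "\<dots> = (\<integral>\<^sup>+\<omega>. ?h (\<omega> n) \<partial>history_law (Suc n))"
    by (intro nn_integral_cong)
      (simp only: space_history_law nn_integral_trajectory_step_Suc[OF _ Suc.prems] case_prod_unfold)
  also have "\<dots> = (\<integral>\<^sup>+s. \<integral>\<^sup>+a. ?h (s, a) \<partial>\<pi> s \<partial>state_law \<nu> n)"
    by (rule Suc.IH[OF h])
  \<comment> \<open>Drawing an action and then a successor is one step of the state chain, which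
    advances \<open>state_law\<close> from \<open>n\<close> to \<open>Suc n\<close>.\<close>
  also have "\<dots> = (\<integral>\<^sup>+s. \<integral>\<^sup>+s'. ?g s' \<partial>state_kernel P \<pi> s \<partial>state_law \<nu> n)"
    by (intro nn_integral_cong) (simp add: space_law nn_integral_state_kernel[OF g])
  also have "\<dots> = (\<integral>\<^sup>+s. ?g s \<partial>state_law \<nu> (Suc n))"
    unfolding state_law_Suc[OF \<nu>] using nn_integral_bind[OF g K] by simp
  finally show ?case .
qed

lemma distr_trajectory_law_transition:
  "distr (trajectory_law X A P \<pi> \<nu>) (X \<Otimes>\<^sub>M A \<Otimes>\<^sub>M X) (\<lambda>\<omega>. (fst (\<omega> t), snd (\<omega> t), fst (\<omega> (Suc t))))
    = transition_law X A P \<pi> (state_law \<nu> t)"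
proof (rule measure_eqI)
  let ?L = "trajectory_law X A P \<pi> \<nu>"
  let ?T = "\<lambda>\<omega> :: nat \<Rightarrow> 's \<times> 'a. (fst (\<omega> t), snd (\<omega> t), fst (\<omega> (Suc t)))"
  have law: "transition_law X A P \<pi> (state_law \<nu> t) \<in> space (prob_algebra (X \<Otimes>\<^sub>M A \<Otimes>\<^sub>M X))"
    by (intro transition_law_in_prob_algebra state_law_in_prob_algebra \<nu>)
  then show "sets (distr ?L (X \<Otimes>\<^sub>M A \<Otimes>\<^sub>M X) ?T) = sets (transition_law X A P \<pi> (state_law \<nu> t))"
    by (simp add: space_prob_algebra)
  fix B assume "B \<in> sets (distr ?L (X \<Otimes>\<^sub>M A \<Otimes>\<^sub>M X) ?T)"
  then have B: "B \<in> sets (X \<Otimes>\<^sub>M A \<Otimes>\<^sub>M X)" by simp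
  \<comment> \<open>Testing with indicators turns equality of the two measures into an equality of
    nonnegative integrals, to which the unfolding rules apply.\<close>
  define f :: "'s \<times> 'a \<times> 's \<Rightarrow> ennreal" where "f = indicator B"
  have f[measurable]: "f \<in> borel_measurable (X \<Otimes>\<^sub>M A \<Otimes>\<^sub>M X)" using B by (simp add: f_def)
  note [measurable_cong] = sets_trajectory_law
  \<comment> \<open>A transition at time \<open>t\<close> reads the coordinates \<open>t\<close> and
    \<open>Suc t\<close>, hence a history of length \<open>Suc (Suc t)\<close>.\<close>
  have T_hist[measurable]: "?T \<in> history_space (Suc (Suc t)) \<rightarrow>\<^sub>M X \<Otimes>\<^sub>M A \<Otimes>\<^sub>M X"
  proof -
    have [measurable]: "(\<lambda>\<omega>. \<omega> t) \<in> history_space (Suc (Suc t)) \<rightarrow>\<^sub>M X \<Otimes>\<^sub>M A"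
      "(\<lambda>\<omega>. \<omega> (Suc t)) \<in> history_space (Suc (Suc t)) \<rightarrow>\<^sub>M X \<Otimes>\<^sub>M A"
      by (intro measurable_component_singleton; simp)+
    show ?thesis by measurable
  qed
  let ?h = "\<lambda>(s, a). \<integral>\<^sup>+s'. f (s, a, s') \<partial>P s a"
  have h: "?h \<in> borel_measurable (X \<Otimes>\<^sub>M A)"
    using nn_integral_measurable_subprob_algebra2[OF _ measurable_prob_algebraD[OF P],
        of "\<lambda>(s, a) s'. f (s, a, s')"] by (simp add: case_prod_unfold)
  have "(\<integral>\<^sup>+x. f x \<partial>distr ?L (X \<Otimes>\<^sub>M A \<Otimes>\<^sub>M X) ?T) = (\<integral>\<^sup>+\<omega>. f (?T \<omega>) \<partial>?L)"
    by (intro nn_integral_distr f) measurable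
  also have "\<dots> = (\<integral>\<^sup>+\<omega>. f (?T \<omega>) \<partial>history_law (Suc (Suc t)))"
    unfolding distr_trajectory_law_restrict[of "Suc (Suc t)", symmetric]
    by (subst nn_integral_distr) (auto intro!: measurable_restrict)
  also have "\<dots> = (\<integral>\<^sup>+\<omega>. \<integral>\<^sup>+x. f (fst (\<omega> t), snd (\<omega> t), fst x) \<partial>trajectory_step X A P \<pi> \<nu> (Suc t) \<omega> \<partial>history_law (Suc t))"
    by (subst nn_integral_history_law_Suc) auto
  also have "\<dots> = (\<integral>\<^sup>+\<omega>. ?h (\<omega> t) \<partial>history_law (Suc t))"
  proof (intro nn_integral_cong)
    fix \<omega> assume "\<omega> \<in> space (history_law (Suc t))"
    then have \<omega>: "\<omega> \<in> space (history_space (Suc t))" by (simp only: space_history_law)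
    then have "\<omega> t \<in> space (X \<Otimes>\<^sub>M A)" by (auto simp: space_PiM PiE_iff)
    then have sa[measurable]: "fst (\<omega> t) \<in> space X" "snd (\<omega> t) \<in> space A" by (auto simp: space_pair_measure)
    have space_P: "space (P (fst (\<omega> t)) (snd (\<omega> t))) = space X"
      using kernel_in_prob_algebra[OF sa] by (auto simp: space_prob_algebra dest: sets_eq_imp_space_eq)
    \<comment> \<open>The last pair of the history also contains the action at time
      \<open>Suc t\<close>. The integrand ignores it, so that integral only contributes the factor
      1.\<close>
    have "emeasure (\<pi> s) (space (\<pi> s)) = 1" if "s \<in> space X" for s
      using measurable_space[OF policy that] by (auto simp: space_prob_algebra intro: prob_space.emeasure_space_1)
    then have "(\<integral>\<^sup>+s. \<integral>\<^sup>+a. f (fst (\<omega> t), snd (\<omega> t), s) \<partial>\<pi> s \<partial>P (fst (\<omega> t)) (snd (\<omega> t))) = ?h (\<omega> t)"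
      unfolding case_prod_unfold by (intro nn_integral_cong) (simp add: space_P)
    moreover have "(\<lambda>x. f (fst (\<omega> t), snd (\<omega> t), fst x)) \<in> borel_measurable (X \<Otimes>\<^sub>M A)" by measurable
    ultimately show "(\<integral>\<^sup>+x. f (fst (\<omega> t), snd (\<omega> t), fst x) \<partial>trajectory_step X A P \<pi> \<nu> (Suc t) \<omega>) = ?h (\<omega> t)"
      by (simp only: nn_integral_trajectory_step_Suc[OF \<omega>] fst_conv)
  qed
  also have "\<dots> = (\<integral>\<^sup>+s. \<integral>\<^sup>+a. \<integral>\<^sup>+s'. f (s, a, s') \<partial>P s a \<partial>\<pi> s \<partial>state_law \<nu> t)"
    using nn_integral_history_law_last[OF h] by simp
  also have "\<dots> = (\<integral>\<^sup>+x. f x \<partial>transition_law X A P \<pi> (state_law \<nu> t))"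
    by (rule nn_integral_transition_law[OF state_law_in_prob_algebra[OF \<nu>] f, symmetric])
  finally show "emeasure (distr ?L (X \<Otimes>\<^sub>M A \<Otimes>\<^sub>M X) ?T) B = emeasure (transition_law X A P \<pi> (state_law \<nu> t)) B"
    using B law by (simp add: f_def space_prob_algebra)
qed

text \<open>Boundedness of \<open>f\<close> serves twice: it makes each summand integrable, so that
  the expectation can be taken term by term, and it lets setwise convergence pass to
  integrals.\<close>

lemma time_average_tendsto:
  fixes f :: "'s \<times> 'a \<times> 's \<Rightarrow> real"
  assumes erg: "ergodic_chain X (state_kernel P \<pi>) \<mu>"
    and f[measurable]: "f \<in> borel_measurable (X \<Otimes>\<^sub>M A \<Otimes>\<^sub>M X)"
    and bound: "\<And>x. x \<in> space (X \<Otimes>\<^sub>M A \<Otimes>\<^sub>M X) \<Longrightarrow> \<bar>f x\<bar> \<le> C"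
  shows "(\<lambda>T. 1 / real T *
      (\<integral>\<omega>. (\<Sum>t<T. f (fst (\<omega> t), snd (\<omega> t), fst (\<omega> (Suc t)))) \<partial>trajectory_law X A P \<pi> \<nu>))
    \<longlonglongrightarrow> (\<integral>x. f x \<partial>transition_law X A P \<pi> \<mu>)"
proof -
  let ?L = "trajectory_law X A P \<pi> \<nu>"
  let ?T = "\<lambda>t (\<omega> :: nat \<Rightarrow> 's \<times> 'a). (fst (\<omega> t), snd (\<omega> t), fst (\<omega> (Suc t)))"
  note [measurable_cong] = sets_trajectory_law
  interpret L: prob_space ?L by (rule prob_space_trajectory_law)
  have T[measurable]: "?T t \<in> ?L \<rightarrow>\<^sub>M X \<Otimes>\<^sub>M A \<Otimes>\<^sub>M X" for t by measurable
  have "integrable ?L (\<lambda>\<omega>. f (?T t \<omega>))" for t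
    using measurable_space[OF T] by (intro L.integrable_const_bound[where B=C]) (auto intro!: AE_I2 bound)
  then have "(\<integral>\<omega>. (\<Sum>t<T. f (?T t \<omega>)) \<partial>?L) = (\<Sum>t<T. \<integral>\<omega>. f (?T t \<omega>) \<partial>?L)" for T
    by (intro Bochner_Integration.integral_sum)
  moreover have "(\<integral>\<omega>. f (?T t \<omega>) \<partial>?L) = (\<integral>x. f x \<partial>transition_law X A P \<pi> (state_law \<nu> t))" for t
    unfolding distr_trajectory_law_transition[symmetric] by (simp add: integral_distr)
  ultimately have sum_eq: "(\<integral>\<omega>. (\<Sum>t<T. f (?T t \<omega>)) \<partial>?L)
      = (\<Sum>t<T. \<integral>x. f x \<partial>transition_law X A P \<pi> (state_law \<nu> t))" for T by simp
  have "(\<lambda>t. \<integral>x. f x \<partial>transition_law X A P \<pi> (state_law \<nu> t)) \<longlonglongrightarrow> (\<integral>x. f x \<partial>transition_law X A P \<pi> \<mu>)"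
  proof (rule setwise_convergence_integral[OF _ _ _ f bound])
    show "transition_law X A P \<pi> \<mu> \<in> space (prob_algebra (X \<Otimes>\<^sub>M A \<Otimes>\<^sub>M X))"
      using erg by (intro transition_law_in_prob_algebra) (auto simp: ergodic_chain_def is_stationary_def)
  qed (auto intro: transition_law_in_prob_algebra state_law_in_prob_algebra[OF \<nu>]
      setwise_convergence_transition_law[OF erg \<nu>])
  from tendsto_cesaro_mean[OF this] show ?thesis unfolding sum_eq .
qed

end

end

text \<open>The limit is identified, beyond its mere existence, and turns out to be independent of
  the initial law \<nu>. Average rewards of different policies thereby become comparable one-step
  expectations.\<close>

lemma average_reward_eq_stationary_expectation:
  assumes P: "(\<lambda>(s, a). P s a) \<in> state_space S \<Otimes>\<^sub>M A \<rightarrow>\<^sub>M prob_algebra (state_space S)"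
    and \<pi>: "\<pi> \<in> policies S A" and \<nu>: "\<nu> \<in> space (prob_algebra (state_space S))"
    and erg: "ergodic_chain (state_space S) (state_kernel P \<pi>) (stationary_dist S P \<pi>)"
    and f: "(\<lambda>(s, a, s'). f s a s') \<in> borel_measurable (state_space S \<Otimes>\<^sub>M A \<Otimes>\<^sub>M state_space S)"
    and bound: "\<And>s a s'. s \<in> S \<Longrightarrow> a \<in> space A \<Longrightarrow> s' \<in> S \<Longrightarrow> \<bar>f s a s'\<bar> \<le> C"
  shows "average_reward S A P f \<nu> \<pi> = stationary_expectation S A P \<pi> f"
proof -
  interpret policy_chain "state_space S" A P \<pi>
    using P \<pi> by unfold_locales (simp_all add: policies_def)
  have "\<bar>case x of (s, a, s') \<Rightarrow> f s a s'\<bar> \<le> C"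
    if "x \<in> space (state_space S \<Otimes>\<^sub>M A \<Otimes>\<^sub>M state_space S)" for x
    using that bound by (auto simp: space_pair_measure state_space_def space_restrict_space)
  from time_average_tendsto[OF \<nu> erg f this]
  have "mean_reward S A P f \<nu> \<pi> \<longlonglongrightarrow> stationary_expectation S A P \<pi> f"
    unfolding mean_reward_def stationary_expectation_def by (simp only: prod.case)
  then show ?thesis unfolding average_reward_def by (rule limI)
qed

section \<open>Regularity of the radial and tangential reward terms\<close>

lemma measurable_transition_continuous:
  fixes q :: "real^'n \<Rightarrow> real^'n \<Rightarrow> real"
  assumes "continuous_on (S \<times> S) (\<lambda>(s, s'). q s s')"
  shows "(\<lambda>(s, a, s'). q s s') \<in> borel_measurable (state_space S \<Otimes>\<^sub>M A \<Otimes>\<^sub>M state_space S)"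
proof -
  have [measurable]: "(\<lambda>s. s) \<in> state_space S \<rightarrow>\<^sub>M borel"
    unfolding state_space_def by (rule measurable_restrict_space1) simp
  have "(\<lambda>x. (fst x, snd (snd x))) \<in> state_space S \<Otimes>\<^sub>M A \<Otimes>\<^sub>M state_space S \<rightarrow>\<^sub>M borel \<Otimes>\<^sub>M borel"
    by measurable
  \<comment> \<open>On Euclidean space the product of the Borel algebras is the Borel algebra of the
    product, so the pair of states can be viewed in \<open>S \<times> S\<close>, where
    \<open>q\<close> is continuous.\<close>
  then have "(\<lambda>x. (fst x, snd (snd x))) \<in> state_space S \<Otimes>\<^sub>M A \<Otimes>\<^sub>M state_space S \<rightarrow>\<^sub>M restrict_space borel (S \<times> S)"
    unfolding borel_prod
    by (rule measurable_restrict_space2[rotated]) (auto simp: space_pair_measure state_space_def space_restrict_space)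
  from measurable_compose[OF this borel_measurable_continuous_on_restrict[OF assms]]
  show ?thesis by (simp add: case_prod_unfold)
qed

lemma bounded_transition_continuous:
  fixes q :: "real^'n \<Rightarrow> real^'n \<Rightarrow> real"
  assumes "compact S" "continuous_on (S \<times> S) (\<lambda>(s, s'). q s s')"
  obtains C where "\<And>s s'. s \<in> S \<Longrightarrow> s' \<in> S \<Longrightarrow> \<bar>q s s'\<bar> \<le> C"
proof -
  have "bounded ((\<lambda>(s, s'). q s s') ` (S \<times> S))"
    by (intro compact_imp_bounded compact_continuous_image assms compact_Times)
  then obtain C where "\<forall>y\<in>(\<lambda>(s, s'). q s s') ` (S \<times> S). norm y \<le> C"
    by (auto simp: bounded_iff)
  then show thesis by (intro that[of C]) auto
qed

text \<open>Since tanh is odd, the sign and the absolute value cancel. The resulting form is visibly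
  continuous across the level set, where \<open>sgn\<close> jumps.\<close>

lemma radial_weight_eq_tanh: "radial_weight U c s = tanh (c - U s)"
  using tanh_minus[of "U s - c"] by (auto simp: radial_weight_def abs_if sgn_if)

lemma continuous_on_fst_comp:
  "continuous_on S f \<Longrightarrow> continuous_on (S \<times> T) (\<lambda>x. f (fst x))"
  by (rule continuous_on_compose2[of S f]) (auto intro: continuous_intros)

text \<open>By uniqueness, \<open>gradient U\<close> agrees on \<open>S\<close> with the witness
  \<open>g\<close>, which is continuous there because it is differentiable.\<close>

lemma twice_continuously_differentiable_onD:
  assumes "twice_continuously_differentiable_on U S"
  shows "continuous_on S U" "continuous_on S (gradient U)"
proof -
  obtain T g H where T: "S \<subseteq> T" and g: "\<And>x. x \<in> T \<Longrightarrow> GDERIV U x :> g x"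
    and H: "\<And>x. x \<in> T \<Longrightarrow> (g has_derivative (\<lambda>v. H x *v v)) (at x)"
    using assms unfolding twice_continuously_differentiable_on_def by blast
  show "continuous_on S U"
    using g T unfolding gderiv_def
    by (intro continuous_at_imp_continuous_on ballI has_derivative_continuous) blast
  have "continuous_on S g"
    using H T by (intro continuous_at_imp_continuous_on ballI has_derivative_continuous) blast
  then show "continuous_on S (gradient U)"
    using GDERIV_gradient[OF g] T by (subst continuous_on_cong[where g=g]) auto
qed

section \<open>Comparison of the optimal policy with the reference policy on the level set\<close>

theorem corollary1:
  fixes S :: "(real^'n) set"
    and A :: "'a measure"
    and P :: "real^'n \<Rightarrow> 'a \<Rightarrow> (real^'n) measure"
    and r :: "real^'n \<Rightarrow> 'a \<Rightarrow> real"
    and U :: "real^'n \<Rightarrow> real"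
    and W :: "real^'n^'n"
    and R_max U_mid v_max v0 \<eta> :: real
    and \<nu> :: "(real^'n) measure"
    and \<pi>\<^sub>U \<pi>_opt :: "real^'n \<Rightarrow> 'a measure"
  assumes S: "compact S"
    and P: "(\<lambda>(s, a). P s a) \<in> state_space S \<Otimes>\<^sub>M A \<rightarrow>\<^sub>M prob_algebra (state_space S)"
    and r_measurable: "(\<lambda>(s, a). r s a) \<in> borel_measurable (state_space S \<Otimes>\<^sub>M A)"
    and r_bounded: "\<forall>s\<in>S. \<forall>a\<in>space A. \<bar>r s a\<bar> \<le> R_max"
    and initial: "\<nu> \<in> space (prob_algebra (state_space S))"
    and U: "twice_continuously_differentiable_on U S"
    and W: "transpose W = - W"
    and curvature: "bdd_above ((\<lambda>x. onorm ((*v) (hessian (log_cosh_potential U U_mid) x))) ` S)"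
    and A1: "\<exists>g0>0. \<exists>N. open N \<and> level_set S U U_mid \<subseteq> N \<and> (\<forall>s\<in>N \<inter> S. norm (gradient U s) \<ge> g0)"
    and A2: "\<forall>\<pi>\<in>policies S A.
        (\<exists>!\<mu>. is_stationary (state_space S) (state_kernel P \<pi>) \<mu>) \<and>
        ergodic_chain (state_space S) (state_kernel P \<pi>) (stationary_dist S P \<pi>) \<and>
        convergent (mean_reward S A P (shaped_reward r U U_mid W) \<nu> \<pi>)"
    and A3_policy: "\<pi>\<^sub>U \<in> policies S A"
    and A3_i: "measure (stationary_dist S P \<pi>\<^sub>U) (level_set S U U_mid) = 1"
    and A3_v0: "v0 > 0"
    and A3_ii: "stationary_expectation S A P \<pi>\<^sub>U (\<lambda>s a s'. tangential_step U W s s') \<ge> v0"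
    and A3_v_max: "\<forall>\<pi>\<in>policies S A.
        stationary_expectation S A P \<pi> (\<lambda>s a s'. \<bar>tangential_step U W s s'\<bar>) \<le> v_max"
    and \<eta>: "\<eta> \<ge> 0"
    and near_optimal: "stationary_expectation S A P \<pi>\<^sub>U (\<lambda>s a s'. r s a) \<ge>
        (SUP \<pi>\<in>{\<pi>\<in>policies S A. measure (stationary_dist S P \<pi>) (level_set S U U_mid) = 1}.
           stationary_expectation S A P \<pi> (\<lambda>s a s'. r s a)) - \<eta>"
    and optimal: "is_arg_max (average_reward S A P (shaped_reward r U U_mid W) \<nu>)
        (\<lambda>\<pi>. \<pi> \<in> policies S A) \<pi>_opt"
    and supported: "measure (stationary_dist S P \<pi>_opt) (level_set S U U_mid) = 1"
  shows "stationary_expectation S A P \<pi>_opt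
           (\<lambda>s a s'. tangential_weight U U_mid s * tangential_step U W s s') \<ge> v0 - \<eta> \<and>
         (\<eta> < v0 \<longrightarrow>
           stationary_expectation S A P \<pi>_opt
             (\<lambda>s a s'. tangential_weight U U_mid s * tangential_step U W s s') > 0 \<and>
           \<not> (\<exists>B\<in>sets (state_space S). measure (stationary_dist S P \<pi>_opt) B = 1 \<and>
                (\<forall>s\<in>B. AE s' in state_kernel P \<pi>_opt s. s' = s)))"
proof -
  let ?X = "state_space S" and ?E = "stationary_expectation S A P" and ?\<mu> = "stationary_dist S P"
  let ?M = "?X \<Otimes>\<^sub>M A \<Otimes>\<^sub>M ?X"
  let ?L = "\<lambda>\<pi>. transition_law ?X A P \<pi> (?\<mu> \<pi>)"
  let ?tan = "tangential_step U W"
  let ?wtan = "\<lambda>s s'. tangential_weight U U_mid s * ?tan s s'"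
  let ?rad = "\<lambda>s s'. radial_weight U U_mid s * (gradient U s \<bullet> (s' - s))"
  let ?R = "shaped_reward r U U_mid W"
  note U_cont = twice_continuously_differentiable_onD[OF U]
  have space_X: "space ?X = S" by (simp add: state_space_def space_restrict_space)
  have U_cont': "continuous_on (S \<times> S) (\<lambda>x. U (fst x))" "continuous_on (S \<times> S) (\<lambda>x. gradient U (fst x))"
    "continuous_on (S \<times> S) (\<lambda>x. W *v gradient U (fst x))"
    by (intro continuous_on_fst_comp U_cont continuous_on_compose2[OF matrix_vector_mult_linear_continuous_on[of UNIV]];
        simp)+
  have tan: "continuous_on (S \<times> S) (\<lambda>(s, s'). ?tan s s')"
    unfolding tangential_step_def case_prod_unfold by (intro continuous_intros U_cont')
  have wtan: "continuous_on (S \<times> S) (\<lambda>(s, s'). ?wtan s s')"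
    unfolding tangential_weight_def using tan unfolding case_prod_unfold
    by (intro continuous_intros U_cont') auto
  have rad: "continuous_on (S \<times> S) (\<lambda>(s, s'). ?rad s s')"
    unfolding radial_weight_eq_tanh case_prod_unfold by (intro continuous_intros U_cont') auto
  have U_meas[measurable]: "U \<in> borel_measurable ?X"
    unfolding state_space_def by (rule borel_measurable_continuous_on_restrict[OF U_cont(1)])
  note tan_meas[measurable] = measurable_transition_continuous[OF tan, of A]
    and wtan_meas[measurable] = measurable_transition_continuous[OF wtan, of A]
    and rad_meas[measurable] = measurable_transition_continuous[OF rad, of A]
  \<comment> \<open>Compactness of \<open>S\<close> bounds both geometric terms. Together with
    \<open>R_max\<close> this bounds the shaped reward, as the limit of its time averages
    requires.\<close>
  obtain C_wtan where C_wtan: "\<And>s s'. s \<in> S \<Longrightarrow> s' \<in> S \<Longrightarrow> \<bar>?wtan s s'\<bar> \<le> C_wtan"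
    using bounded_transition_continuous[OF S wtan] by blast
  obtain C_rad where C_rad: "\<And>s s'. s \<in> S \<Longrightarrow> s' \<in> S \<Longrightarrow> \<bar>?rad s s'\<bar> \<le> C_rad"
    using bounded_transition_continuous[OF S rad] by blast
  have r_meas[measurable]: "(\<lambda>(s, a, s'). r s a) \<in> borel_measurable ?M"
    using measurable_compose[OF _ r_measurable, of "\<lambda>x. (fst x, fst (snd x))" ?M]
    by (simp add: case_prod_unfold)
  have R_meas: "(\<lambda>(s, a, s'). ?R s a s') \<in> borel_measurable ?M"
    using borel_measurable_add[OF borel_measurable_add[OF r_meas rad_meas] wtan_meas]
    by (simp add: shaped_reward_def case_prod_unfold)
  have R_bound: "\<bar>?R s a s'\<bar> \<le> R_max + C_rad + C_wtan" if "s \<in> S" "a \<in> space A" "s' \<in> S" for s a s'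
    using C_rad[OF that(1,3)] C_wtan[OF that(1,3)] r_bounded[rule_format, OF that(1,2)]
    unfolding shaped_reward_def by linarith

  have chain: "policy_chain ?X A P \<pi>" if "\<pi> \<in> policies S A" for \<pi>
    using that P by unfold_locales (simp_all add: policies_def)
  have stat: "?\<mu> \<pi> \<in> space (prob_algebra ?X)" if "\<pi> \<in> policies S A" for \<pi>
    using A2 that by (auto simp: ergodic_chain_def is_stationary_def)
  have law: "?L \<pi> \<in> space (prob_algebra ?M)" if "\<pi> \<in> policies S A" for \<pi>
    using policy_chain.transition_law_in_prob_algebra[OF chain[OF that] stat[OF that]] .
  have integrable: "integrable (?L \<pi>) (\<lambda>(s, a, s'). f s a s')"
    if \<pi>: "\<pi> \<in> policies S A" and f: "(\<lambda>(s, a, s'). f s a s') \<in> borel_measurable ?M"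
      and bound: "\<And>s a s'. s \<in> S \<Longrightarrow> a \<in> space A \<Longrightarrow> s' \<in> S \<Longrightarrow> \<bar>f s a s'\<bar> \<le> C" for \<pi> f and C :: real
  proof -
    have "prob_space (?L \<pi>)" and sets: "sets (?L \<pi>) = sets ?M" using law[OF \<pi>] by (auto simp: space_prob_algebra)
    then interpret L: prob_space "?L \<pi>" by simp
    show ?thesis
      using bound f sets_eq_imp_space_eq[OF sets]
      by (intro L.integrable_const_bound[where B=C])
        (auto simp: space_pair_measure space_X measurable_cong_sets[OF sets refl])
  qed
  have int_r: "integrable (?L \<pi>) (\<lambda>(s, a, s'). r s a)" if "\<pi> \<in> policies S A" for \<pi>
    by (rule integrable[OF that r_meas, of R_max]) (use r_bounded in auto)
  have int_wtan: "integrable (?L \<pi>) (\<lambda>(s, a, s'). ?wtan s s')" if "\<pi> \<in> policies S A" for \<pi>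
    by (rule integrable[OF that wtan_meas C_wtan])

  have on_level: "AE (s, a, s') in ?L \<pi>. U s = U_mid"
    if \<pi>: "\<pi> \<in> policies S A" and sup: "measure (?\<mu> \<pi>) (level_set S U U_mid) = 1" for \<pi>
  proof -
    have "prob_space (?\<mu> \<pi>)" using stat[OF \<pi>] by (simp add: space_prob_algebra)
    from prob_space.AE_prob_1[OF this sup] have "AE s in ?\<mu> \<pi>. U s = U_mid"
      by eventually_elim (simp add: level_set_def)
    then have "AE s in ?\<mu> \<pi>. AE a in \<pi> s. AE s' in P s a. U s = U_mid"
      by eventually_elim simp
    moreover have "Measurable.pred ?M (\<lambda>(s, a, s'). U s = U_mid)" by measurable
    ultimately show ?thesis
      using policy_chain.AE_transition_law_iff[OF chain[OF \<pi>] stat[OF \<pi>]] by simp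
  qed
  \<comment> \<open>Both identities hold for every policy supported on the level set, so they serve
    \<open>\<pi>_opt\<close> and \<open>\<pi>\<^sub>U\<close> alike.\<close>
  have reward_split: "average_reward S A P ?R \<nu> \<pi> = ?E \<pi> (\<lambda>s a s'. r s a) + ?E \<pi> (\<lambda>s a s'. ?wtan s s')"
    and wtan_eq: "?E \<pi> (\<lambda>s a s'. ?wtan s s') = ?E \<pi> (\<lambda>s a s'. ?tan s s')"
    if \<pi>: "\<pi> \<in> policies S A" and sup: "measure (?\<mu> \<pi>) (level_set S U U_mid) = 1" for \<pi>
  proof -
    have sets_L[measurable_cong]: "sets (?L \<pi>) = sets ?M" using law[OF \<pi>] by (simp add: space_prob_algebra)
    have "average_reward S A P ?R \<nu> \<pi> = ?E \<pi> ?R"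
      using average_reward_eq_stationary_expectation[OF P \<pi> initial _ R_meas R_bound] A2 \<pi> by blast
    also have "\<dots> = (\<integral>x. (case x of (s, a, s') \<Rightarrow> r s a) + (case x of (s, a, s') \<Rightarrow> ?wtan s s') \<partial>?L \<pi>)"
      unfolding stationary_expectation_def
    proof (rule integral_cong_AE)
      show "AE x in ?L \<pi>. (case x of (s, a, s') \<Rightarrow> ?R s a s')
          = (case x of (s, a, s') \<Rightarrow> r s a) + (case x of (s, a, s') \<Rightarrow> ?wtan s s')"
        using on_level[OF \<pi> sup]
        by eventually_elim (auto simp: shaped_reward_def radial_weight_def)
    qed (use R_meas in measurable)
    also have "\<dots> = ?E \<pi> (\<lambda>s a s'. r s a) + ?E \<pi> (\<lambda>s a s'. ?wtan s s')"
      unfolding stationary_expectation_def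
      by (rule Bochner_Integration.integral_add[OF int_r[OF \<pi>] int_wtan[OF \<pi>]])
    finally show "average_reward S A P ?R \<nu> \<pi> = ?E \<pi> (\<lambda>s a s'. r s a) + ?E \<pi> (\<lambda>s a s'. ?wtan s s')" .
    show "?E \<pi> (\<lambda>s a s'. ?wtan s s') = ?E \<pi> (\<lambda>s a s'. ?tan s s')"
      unfolding stationary_expectation_def
    proof (rule integral_cong_AE)
      show "AE x in ?L \<pi>. (case x of (s, a, s') \<Rightarrow> ?wtan s s') = (case x of (s, a, s') \<Rightarrow> ?tan s s')"
        using on_level[OF \<pi> sup]
        by eventually_elim (auto simp: tangential_weight_def)
    qed measurable
  qed

  have opt: "\<pi>_opt \<in> policies S A"
    and opt_ge: "average_reward S A P ?R \<nu> \<pi>\<^sub>U \<le> average_reward S A P ?R \<nu> \<pi>_opt"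
    using optimal A3_policy by (auto simp: is_arg_max_def not_less)
  \<comment> \<open>The supremum in \<open>near_optimal\<close> is an upper bound for its members
    only once the family is known to be bounded above; \<open>R_max\<close> provides the
    bound.\<close>
  have "\<bar>?E \<pi> (\<lambda>s a s'. r s a)\<bar> \<le> R_max" if \<pi>: "\<pi> \<in> policies S A" for \<pi>
  proof -
    have "prob_space (?L \<pi>)" and sets: "sets (?L \<pi>) = sets ?M" using law[OF \<pi>] by (auto simp: space_prob_algebra)
    then interpret L: prob_space "?L \<pi>" by simp
    have "norm (?E \<pi> (\<lambda>s a s'. r s a)) \<le> (\<integral>x. norm (case x of (s, a, s') \<Rightarrow> r s a) \<partial>?L \<pi>)"
      unfolding stationary_expectation_def by (rule integral_norm_bound)
    also have "\<dots> \<le> R_max"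
      using int_r[OF \<pi>] r_bounded sets_eq_imp_space_eq[OF sets]
      by (intro L.integral_le_const integrable_norm AE_I2) (auto simp: space_pair_measure space_X)
    finally show ?thesis by simp
  qed
  then have "bdd_above ((\<lambda>\<pi>. ?E \<pi> (\<lambda>s a s'. r s a))
      ` {\<pi>\<in>policies S A. measure (?\<mu> \<pi>) (level_set S U U_mid) = 1})"
    by (intro bdd_aboveI2[where M=R_max]) (auto simp: abs_le_iff)
  from cSUP_upper[OF _ this, of \<pi>_opt] near_optimal opt supported
  have "?E \<pi>_opt (\<lambda>s a s'. r s a) \<le> ?E \<pi>\<^sub>U (\<lambda>s a s'. r s a) + \<eta>" by simp
  \<comment> \<open>Optimality bounds base reward plus motion of \<open>\<pi>_opt\<close> below by
    base reward plus motion of \<open>\<pi>\<^sub>U\<close>. The base reward of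
    \<open>\<pi>_opt\<close> is at most \<eta> larger, so its motion is at most \<eta>
    smaller.\<close>
  with opt_ge A3_ii have motion: "?E \<pi>_opt (\<lambda>s a s'. ?wtan s s') \<ge> v0 - \<eta>"
    unfolding reward_split[OF opt supported] reward_split[OF A3_policy A3_i] wtan_eq[OF A3_policy A3_i]
    by linarith

  have "\<not> (\<exists>B\<in>sets ?X. measure (?\<mu> \<pi>_opt) B = 1 \<and> (\<forall>s\<in>B. AE s' in state_kernel P \<pi>_opt s. s' = s))"
    if "\<eta> < v0"
  proof safe
    fix B assume B: "B \<in> sets ?X" "measure (?\<mu> \<pi>_opt) B = 1"
      and loop: "\<forall>s\<in>B. AE s' in state_kernel P \<pi>_opt s. s' = s"
    interpret policy_chain ?X A P \<pi>_opt by (rule chain[OF opt])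
    have [measurable]: "(\<lambda>s. s) \<in> ?X \<rightarrow>\<^sub>M borel"
      unfolding state_space_def by (rule measurable_restrict_space1) simp
    have "prob_space (?\<mu> \<pi>_opt)" using stat[OF opt] by (simp add: space_prob_algebra)
    from prob_space.AE_prob_1[OF this B(2)]
    have "AE s in ?\<mu> \<pi>_opt. AE a in \<pi>_opt s. AE s' in P s a. s' = s"
    \<comment> \<open>At a state of \<open>B\<close> the loop is known for the kernel mixed over
      actions, hence it holds for almost every action drawn by the policy.\<close>
    proof eventually_elim
      case (elim s)
      then have s: "s \<in> space ?X" using sets.sets_into_space[OF B(1)] by auto
      have "Measurable.pred ?X (\<lambda>s'. s' = s)" by measurable
      from AE_state_kernel_iff[OF this s] loop elim show ?case by auto
    qed
    moreover have "Measurable.pred ?M (\<lambda>(s, a, s'). s' = s)" by measurable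
    ultimately have "AE (s, a, s') in ?L \<pi>_opt. s' = s"
      using AE_transition_law_iff[OF stat[OF opt]] by simp
    then have "AE x in ?L \<pi>_opt. (case x of (s, a, s') \<Rightarrow> ?wtan s s') = 0"
      by eventually_elim (auto simp: tangential_step_def)
    then have "?E \<pi>_opt (\<lambda>s a s'. ?wtan s s') = 0"
      unfolding stationary_expectation_def by (rule integral_eq_zero_AE)
    with motion that show False by simp
  qed
  with motion show ?thesis by auto
qed

end
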